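(* Let $G$ be a graph. If $\tau(G)\leq 2$, then $\omega(G)+\alpha(G)\geq n(G)$.
   Context: Graphs are finite and simple with nonempty vertex set; $n(G)$ is the number of vertices of $G$. A clique is a set of pairwise adjacent vertices, an anticlique is a set of pairwise non-adjacent vertices; maximal means maximal with respect to inclusion. $c(G)$ is the number of maximal cliques and $\overline c(G)$ the number of maximal anticliques of $G$. $\omega(G)$ is the maximum size of a clique and $\alpha(G)$ the maximum size of an anticlique. $\tau(G)=c(G)+\overline c(G)-n(G)$. *)

theory Defs
  imports "HOL-Library.Ramsey"
begin

text \<open>
  A graph is given by its vertex set and its set of edges, which are two-element sets of vertices.
  This is the representation for which \<^const>\<open>clique\<close> and \<^const>\<open>indep\<close> are defined. These two
  predicates do not mention the vertex set of the graph, hence the restriction \<open>K \<subseteq> V\<close> below.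
\<close>

definition simple_graph :: "'a set \<Rightarrow> 'a set set \<Rightarrow> bool" where
  "simple_graph V E \<longleftrightarrow> finite V \<and> V \<noteq> {} \<and> (\<forall>e\<in>E. e \<subseteq> V \<and> card e = 2)"

definition cliques :: "'a set \<Rightarrow> 'a set set \<Rightarrow> 'a set set" where
  "cliques V E = {K. K \<subseteq> V \<and> clique K E}"

definition anticliques :: "'a set \<Rightarrow> 'a set set \<Rightarrow> 'a set set" where
  "anticliques V E = {A. A \<subseteq> V \<and> indep A E}"

definition maximal_members :: "'a set set \<Rightarrow> 'a set set" where
  "maximal_members \<F> = {K \<in> \<F>. \<forall>L\<in>\<F>. K \<subseteq> L \<longrightarrow> L = K}"

definition num_max_cliques :: "'a set \<Rightarrow> 'a set set \<Rightarrow> nat" where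
  "num_max_cliques V E = card (maximal_members (cliques V E))"

definition num_max_anticliques :: "'a set \<Rightarrow> 'a set set \<Rightarrow> nat" where
  "num_max_anticliques V E = card (maximal_members (anticliques V E))"

definition clique_number :: "'a set \<Rightarrow> 'a set set \<Rightarrow> nat" where
  "clique_number V E = Max (card ` cliques V E)"

definition anticlique_number :: "'a set \<Rightarrow> 'a set set \<Rightarrow> nat" where
  "anticlique_number V E = Max (card ` anticliques V E)"

definition tau :: "'a set \<Rightarrow> 'a set set \<Rightarrow> int" where
  "tau V E = int (num_max_cliques V E) + int (num_max_anticliques V E) - int (card V)"

text \<open>The sets under \<^const>\<open>card\<close> and \<^const>\<open>Max\<close> above are finite, and those under \<^const>\<open>Max\<close> nonempty:\<close>

lemma cliques_nonempty: "cliques V E \<noteq> {}"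
  and anticliques_nonempty: "anticliques V E \<noteq> {}"
  by (auto simp: cliques_def anticliques_def intro!: exI[of _ "{}"])

lemma finite_cliques: "finite V \<Longrightarrow> finite (cliques V E)"
  and finite_anticliques: "finite V \<Longrightarrow> finite (anticliques V E)"
  by (simp_all add: cliques_def anticliques_def)

lemma finite_maximal_members: "finite \<F> \<Longrightarrow> finite (maximal_members \<F>)"
  by (simp add: maximal_members_def)

end

theory Submission
  imports Defs
begin

text \<open>
  Write \<open>N V\<close> for the number of maximal cliques plus the number of maximal anticliques of the graph
  induced on \<open>V\<close>. Anticliques of \<open>E\<close> are the cliques of \<open>- E\<close>, so every statement about cliques has a
  dual, obtained by replacing \<open>E\<close> by \<open>- E\<close>. All lower bounds on the number of maximal cliques come from
  one remark: cliques whose pairwise unions are not cliques extend to different maximal cliques.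

  By induction on \<open>V\<close>, three statements are proved together (\<open>num_max_both_bounds\<close>):
  (i) \<open>N V \<ge> |V| + 1\<close>; (ii) if \<open>N V \<le> |V| + 1\<close>, some clique and some anticlique have sizes summing to
  \<open>|V| + 1\<close>; (iii) if \<open>N V \<le> |V| + 2\<close>, some clique and some anticlique have sizes summing to at
  least \<open>|V|\<close>. The theorem is (iii). A vertex adjacent to all others, or to none, can be removed.
  Otherwise let \<open>H\<close> be the set of neighbours and \<open>H'\<close> the set of non-neighbours of a vertex \<open>v\<close>. The maximal
  cliques containing \<open>v\<close> correspond to those of \<open>H\<close>, and those of \<open>H'\<close> extend to maximal cliques
  avoiding \<open>v\<close>, so \<open>N V \<ge> N H + N H'\<close>. As \<open>|V| = |H| + |H'| + 1\<close>, this gives (i). When \<open>N V\<close> is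
  small, it also makes (i) an equality for \<open>H\<close> or \<open>H'\<close>; by (ii), that set is then the union of a clique
  and an anticlique that share a vertex, and this yields a vertex \<open>u\<close> with \<open>N V > N (V - u)\<close>
  (\<open>ex_Suc_num_max_both_if_full_nbrs\<close>).

  So the induction hypothesis gives a large clique \<open>K\<close> and a large anticlique \<open>A\<close> in \<open>V - u\<close>. If they cover
  \<open>V - u\<close>, then adding \<open>u\<close> either makes \<open>N\<close> grow by at least 2 or allows an extension or exchange that
  increases \<open>|K| + |A|\<close> (\<open>split_plus_vertex\<close>). In (ii) they always cover \<open>V - u\<close>, and growth by 2 contradicts (i)
  for \<open>V - u\<close>. In (iii) growth by 2, at whatever vertex, is equally good, because (ii) then applies to
  the smaller graph. There remains the case of (iii) where \<open>K\<close> and \<open>A\<close> share a vertex and miss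
  exactly one vertex of \<open>V - u\<close>. Then either \<open>V - u\<close> has another pair that covers it, or, up to
  complementation, it contains a particular induced 4-cycle (\<open>split_plus_vertex_structure\<close>); in the
  latter case \<open>u\<close> or one of two vertices of that cycle makes \<open>N\<close> grow by 2
  (\<open>delete_two_at_four_cycle\<close>).
\<close>

section \<open>Cliques and maximal cliques\<close>

abbreviation max_cliques :: "'a set \<Rightarrow> 'a set set \<Rightarrow> 'a set set" where
  "max_cliques V E \<equiv> maximal_members (cliques V E)"

text \<open>
  The complement of a graph is represented by \<open>- E\<close>: only the two-element subsets of \<open>V\<close> matter, so
  edge sets need not consist of such subsets. The induced subgraph on \<open>U\<close> is represented by \<open>U\<close> with
  the same \<open>E\<close>.
\<close>

definition num_max_both :: "'a set \<Rightarrow> 'a set set \<Rightarrow> nat" where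
  "num_max_both V E = num_max_cliques V E + num_max_cliques V (- E)"

definition has_pair :: "nat \<Rightarrow> 'a set \<Rightarrow> 'a set set \<Rightarrow> bool" where
  "has_pair m V E \<longleftrightarrow>
     (\<exists>K A. K \<subseteq> V \<and> A \<subseteq> V \<and> clique K E \<and> clique A (- E) \<and> m \<le> card K + card A)"

lemma num_max_both_uminus [simp]: "num_max_both V (- E) = num_max_both V E"
  by (simp add: num_max_both_def)

lemma has_pair_uminus [simp]: "has_pair m V (- E) \<longleftrightarrow> has_pair m V E"
  unfolding has_pair_def by (metis add.commute double_complement)

lemma has_pairI:
  "\<lbrakk>K \<subseteq> V; A \<subseteq> V; clique K E; clique A (- E); m \<le> card K + card A\<rbrakk> \<Longrightarrow> has_pair m V E"
  unfolding has_pair_def by blast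

lemma has_pair_mono: "\<lbrakk>has_pair m U E; U \<subseteq> V; k \<le> m\<rbrakk> \<Longrightarrow> has_pair k V E"
  unfolding has_pair_def by (meson order_trans)

lemma cliqueD: "\<lbrakk>clique K E; u \<in> K; w \<in> K; u \<noteq> w\<rbrakk> \<Longrightarrow> {u, w} \<in> E"
  by (simp add: clique_def)

lemma clique_insert:
  "clique (insert v K) E \<longleftrightarrow> clique K E \<and> (\<forall>u\<in>K. u \<noteq> v \<longrightarrow> {u, v} \<in> E)"
  by (auto simp: clique_def insert_commute)

lemma clique_Int_anticlique:
  assumes "clique K E" "clique A (- E)" "x \<in> K \<inter> A" "y \<in> K \<inter> A"
  shows "x = y"
  using assms by (auto simp: clique_def)

lemma max_cliqueD: "L \<in> max_cliques V E \<Longrightarrow> L \<subseteq> V \<and> clique L E"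
  by (simp add: maximal_members_def cliques_def)

lemma max_clique_eq: "\<lbrakk>L \<in> max_cliques V E; L \<subseteq> M; M \<subseteq> V; clique M E\<rbrakk> \<Longrightarrow> M = L"
  by (simp add: maximal_members_def cliques_def)

lemma max_clique_mem:
  assumes "L \<in> max_cliques V E" "w \<in> V" "\<And>u. \<lbrakk>u \<in> L; u \<noteq> w\<rbrakk> \<Longrightarrow> {u, w} \<in> E"
  shows "w \<in> L"
proof -
  have "clique (insert w L) E"
    using assms(3) max_cliqueD[OF assms(1)] by (auto simp: clique_insert)
  then show ?thesis
    using max_clique_eq[OF assms(1), of "insert w L"] max_cliqueD[OF assms(1)] assms(2) by blast
qed

lemma finite_max_cliques: "finite V \<Longrightarrow> finite (max_cliques V E)"
  by (simp add: finite_cliques finite_maximal_members)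

lemma clique_extends:
  assumes "finite V" "S \<subseteq> V" "clique S E"
  obtains Z where "Z \<in> max_cliques V E" "S \<subseteq> Z"
proof -
  have "finite (cliques V E)" "S \<in> cliques V E"
    using assms by (simp_all add: finite_cliques cliques_def)
  then obtain Z where "Z \<in> cliques V E" "S \<subseteq> Z" "\<forall>L\<in>cliques V E. Z \<subseteq> L \<longrightarrow> L = Z"
    by (metis finite_has_maximal2)
  then show ?thesis using that by (auto simp: maximal_members_def)
qed

lemma max_clique_nonempty:
  assumes "L \<in> max_cliques V E" "V \<noteq> {}"
  shows "L \<noteq> {}"
  using max_clique_mem[OF assms(1)] assms(2) by blast

text \<open>
  A maximal clique that contained two members of the family would contain their union.
\<close>

lemma incompatible_cliques_le:
  assumes "finite V" "\<F> \<subseteq> cliques V E"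
    and incomp: "\<And>S T. \<lbrakk>S \<in> \<F>; T \<in> \<F>; S \<noteq> T\<rbrakk> \<Longrightarrow> \<not> clique (S \<union> T) E"
  shows "card \<F> \<le> num_max_cliques V E"
proof -
  have "\<exists>Z. Z \<in> max_cliques V E \<and> S \<subseteq> Z" if "S \<in> \<F>" for S
  proof -
    have "S \<subseteq> V" "clique S E" using that assms(2) by (auto simp: cliques_def)
    then show ?thesis using clique_extends[OF assms(1)] by metis
  qed
  then obtain g where g: "\<And>S. S \<in> \<F> \<Longrightarrow> g S \<in> max_cliques V E \<and> S \<subseteq> g S"
    by metis
  have "inj_on g \<F>"
  proof (rule inj_onI, rule ccontr)
    fix S T assume "S \<in> \<F>" "T \<in> \<F>" "g S = g T" "S \<noteq> T"
    then have "S \<union> T \<subseteq> g S" "clique (g S) E"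
      using g max_cliqueD by (metis Un_least)+
    then show False
      using incomp \<open>S \<in> \<F>\<close> \<open>T \<in> \<F>\<close> \<open>S \<noteq> T\<close> smaller_clique by blast
  qed
  moreover have "g ` \<F> \<subseteq> max_cliques V E" using g by blast
  ultimately show ?thesis
    unfolding num_max_cliques_def
    using card_inj_on_le finite_max_cliques[OF assms(1)] by blast
qed

lemma incompatible_max_cliques:
  assumes "L \<in> max_cliques V E" "M \<in> max_cliques V E" "L \<noteq> M"
  shows "\<not> clique (L \<union> M) E"
  using assms max_clique_eq[of _ V E "L \<union> M"] max_cliqueD[of _ V E] by (metis Un_upper1 Un_upper2 Un_least)

text \<open>
  The maximal cliques of \<open>V - {v}\<close> are pairwise incompatible. The members of \<open>\<F>\<close> are added to them: a maximal
  clique \<open>L\<close> of \<open>V - {v}\<close> is compatible with a clique \<open>S\<close> containing \<open>v\<close> only if \<open>L\<close> absorbs \<open>S - {v}\<close> and is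
  itself contained in the neighbourhood of \<open>v\<close>. Below, a clique \<open>S\<close> through \<open>v\<close> for which there is no such
  \<open>L\<close> is called new with respect to \<open>V - {v}\<close>.
\<close>

lemma num_max_cliques_delete:
  assumes fin: "finite V" and v: "v \<in> V"
    and fam: "\<And>S. S \<in> \<F> \<Longrightarrow> S \<subseteq> V \<and> v \<in> S \<and> clique S E"
    and incomp: "\<And>S T. \<lbrakk>S \<in> \<F>; T \<in> \<F>; S \<noteq> T\<rbrakk> \<Longrightarrow> \<not> clique (S \<union> T) E"
    and lonely: "\<And>S L. \<lbrakk>S \<in> \<F>; L \<in> max_cliques (V - {v}) E; S - {v} \<subseteq> L; clique (insert v L) E\<rbrakk> \<Longrightarrow> False"
  shows "num_max_cliques (V - {v}) E + card \<F> \<le> num_max_cliques V E"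
proof -
  let ?M = "max_cliques (V - {v}) E"
  have finM: "finite ?M" using fin by (simp add: finite_max_cliques)
  have M: "L \<subseteq> V \<and> v \<notin> L \<and> clique L E" if "L \<in> ?M" for L
    using max_cliqueD[OF that] by blast
  have subF: "\<F> \<subseteq> Pow V" using fam by blast
  then have finF: "finite \<F>" using fin finite_subset by blast
  have disj: "?M \<inter> \<F> = {}" using M fam by blast
  have mixed: "\<not> clique (L \<union> S) E" if "L \<in> ?M" "S \<in> \<F>" for L S
  proof
    assume cl: "clique (L \<union> S) E"
    have "L \<union> (S - {v}) = L"
      by (rule max_clique_eq[OF that(1)])
         (use M[OF that(1)] fam[OF that(2)] smaller_clique[OF cl, of "L \<union> (S - {v})"] in auto)
    then have "S - {v} \<subseteq> L" by blast
    moreover have "clique (insert v L) E"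
      using smaller_clique[OF cl] fam[OF that(2)] by blast
    ultimately show False using lonely that by blast
  qed
  have "card (?M \<union> \<F>) \<le> num_max_cliques V E"
  proof (rule incompatible_cliques_le[OF fin])
    show "?M \<union> \<F> \<subseteq> cliques V E" using M fam unfolding cliques_def by blast
    fix S T assume "S \<in> ?M \<union> \<F>" "T \<in> ?M \<union> \<F>" "S \<noteq> T"
    then consider "S \<in> ?M" "T \<in> ?M" | "S \<in> ?M" "T \<in> \<F>" | "T \<in> ?M" "S \<in> \<F>" | "S \<in> \<F>" "T \<in> \<F>"
      by blast
    then show "\<not> clique (S \<union> T) E"
    proof cases
      case 1 then show ?thesis using incompatible_max_cliques \<open>S \<noteq> T\<close> by blast
    next
      case 2 then show ?thesis using mixed by blast
    next
      case 3 then show ?thesis using mixed[of T S] by (simp add: Un_commute)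
    next
      case 4 then show ?thesis using incomp \<open>S \<noteq> T\<close> by blast
    qed
  qed
  then show ?thesis
    using card_Un_disjoint[OF finM finF disj] by (simp add: num_max_cliques_def)
qed

lemma num_max_cliques_delete_mono:
  "\<lbrakk>finite V; v \<in> V\<rbrakk> \<Longrightarrow> num_max_cliques (V - {v}) E \<le> num_max_cliques V E"
  using num_max_cliques_delete[of V v "{}" E] by simp

lemma num_max_cliques_pos: "finite V \<Longrightarrow> 0 < num_max_cliques V E"
  using incompatible_cliques_le[of V "{{}}" E] by (fastforce simp: cliques_def clique_def)

lemma num_max_cliques_delete_Suc:
  assumes "finite V" "S \<subseteq> V" "v \<in> S" "clique S E"
    and "\<And>L. \<lbrakk>L \<in> max_cliques (V - {v}) E; S - {v} \<subseteq> L; clique (insert v L) E\<rbrakk> \<Longrightarrow> False"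
  shows "Suc (num_max_cliques (V - {v}) E) \<le> num_max_cliques V E"
  using num_max_cliques_delete[of V v "{S}" E] assms by auto

lemma num_max_both_delete_Suc:
  assumes "finite V" "v \<in> V" "Suc (num_max_cliques (V - {v}) E) \<le> num_max_cliques V E"
  shows "Suc (num_max_both (V - {v}) E) \<le> num_max_both V E"
  using assms num_max_cliques_delete_mono[of V v "- E"] by (simp add: num_max_both_def)

text \<open>
  A frequent way to gain 2: two non-adjacent neighbours of \<open>v\<close>, neither of which lies in a maximal clique
  of \<open>V - {v}\<close> consisting of neighbours of \<open>v\<close>, give the two new cliques \<open>{s, v}\<close> and \<open>{s', v}\<close>.
\<close>

lemma num_max_both_delete_two:
  assumes fin: "finite V" and v: "v \<in> V" and ss: "s \<in> V" "s' \<in> V"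
    and e: "{s, v} \<in> E" "{s', v} \<in> E" "{s, s'} \<notin> E" and d: "v \<noteq> s" "v \<noteq> s'" "s \<noteq> s'"
    and lonely: "\<And>L. \<lbrakk>L \<in> max_cliques (V - {v}) E; s \<in> L; clique (insert v L) E\<rbrakk> \<Longrightarrow> False"
      "\<And>L. \<lbrakk>L \<in> max_cliques (V - {v}) E; s' \<in> L; clique (insert v L) E\<rbrakk> \<Longrightarrow> False"
  shows "num_max_both (V - {v}) E + 2 \<le> num_max_both V E"
proof -
  have "card {{s, v}, {s', v}} = 2" using d by (auto simp: doubleton_eq_iff)
  moreover have "num_max_cliques (V - {v}) E + card {{s, v}, {s', v}} \<le> num_max_cliques V E"
    by (rule num_max_cliques_delete[OF fin v])
       (use v ss e d lonely in \<open>auto simp: clique_def insert_commute\<close>)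
  ultimately show ?thesis
    using num_max_cliques_delete_mono[OF fin v, of "- E"] by (simp add: num_max_both_def)
qed

section \<open>Neighbourhoods of a vertex\<close>

definition nbrs :: "'a set \<Rightarrow> 'a set set \<Rightarrow> 'a \<Rightarrow> 'a set" where
  "nbrs V E v = {u \<in> V. u \<noteq> v \<and> {u, v} \<in> E}"

text \<open>
  Two kinds of cliques are pairwise incompatible: \<open>v\<close> together with a maximal clique among its neighbours,
  and a maximal clique among its non-neighbours. The latter is nonempty, so it cannot be united with a
  clique containing \<open>v\<close>.
\<close>

lemma num_max_cliques_split:
  assumes fin: "finite V" and v: "v \<in> V" and ne: "nbrs V (- E) v \<noteq> {}"
  shows "num_max_cliques (nbrs V E v) E + num_max_cliques (nbrs V (- E) v) E \<le> num_max_cliques V E"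
proof -
  let ?H = "nbrs V E v" and ?H' = "nbrs V (- E) v"
  let ?M = "insert v ` max_cliques ?H E" and ?M' = "max_cliques ?H' E"
  have fH: "finite ?H" "finite ?H'" using fin by (simp_all add: nbrs_def)
  have HH: "L \<subseteq> ?H \<and> clique L E \<and> v \<notin> L \<and> (\<forall>u\<in>L. {u, v} \<in> E)" if "L \<in> max_cliques ?H E" for L
    using max_cliqueD[OF that] by (auto simp: nbrs_def)
  have HH': "L \<subseteq> ?H' \<and> clique L E \<and> L \<noteq> {} \<and> v \<notin> L \<and> (\<forall>u\<in>L. {u, v} \<notin> E)"
    if "L \<in> ?M'" for L
    using max_cliqueD[OF that] max_clique_nonempty[OF that ne] by (auto simp: nbrs_def)
  have mixed: "\<not> clique (S \<union> T) E" if "S \<in> ?M" "T \<in> ?M'" for S T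
  proof
    assume cl: "clique (S \<union> T) E"
    have T: "T \<noteq> {}" "v \<notin> T" "\<forall>u\<in>T. {u, v} \<notin> E" using HH'[OF that(2)] by blast+
    moreover have "v \<in> S" using that(1) by blast
    ultimately show False using cl by (metis Un_iff cliqueD equals0I)
  qed
  have same: "\<not> clique (S \<union> T) E" if "S \<in> ?M" "T \<in> ?M" "S \<noteq> T" for S T
  proof -
    obtain S' T' where "S = insert v S'" "T = insert v T'" "S' \<in> max_cliques ?H E"
      "T' \<in> max_cliques ?H E" "S' \<noteq> T'" using \<open>S \<in> ?M\<close> \<open>T \<in> ?M\<close> \<open>S \<noteq> T\<close> by blast
    then show ?thesis
      using incompatible_max_cliques[of S' ?H E T'] smaller_clique[of "S \<union> T" E "S' \<union> T'"] by blast
  qed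
  have "card (?M \<union> ?M') \<le> num_max_cliques V E"
  proof (rule incompatible_cliques_le[OF fin])
    have "S \<subseteq> V \<and> clique S E" if "S \<in> ?M" for S
    proof -
      obtain L where "L \<in> max_cliques ?H E" "S = insert v L" using \<open>S \<in> ?M\<close> by blast
      then show ?thesis using HH[of L] v by (auto simp: clique_insert nbrs_def)
    qed
    moreover have "S \<subseteq> V \<and> clique S E" if "S \<in> ?M'" for S
      using HH'[OF that] by (auto simp: nbrs_def)
    ultimately show "?M \<union> ?M' \<subseteq> cliques V E"
      unfolding cliques_def by blast
    fix S T assume "S \<in> ?M \<union> ?M'" "T \<in> ?M \<union> ?M'" "S \<noteq> T"
    then consider "S \<in> ?M" "T \<in> ?M" | "S \<in> ?M" "T \<in> ?M'" | "T \<in> ?M" "S \<in> ?M'" | "S \<in> ?M'" "T \<in> ?M'"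
      by blast
    then show "\<not> clique (S \<union> T) E"
    proof cases
      case 1 then show ?thesis using same \<open>S \<noteq> T\<close> by blast
    next
      case 2 then show ?thesis using mixed by blast
    next
      case 3 then show ?thesis using mixed[of T S] by (simp add: Un_commute)
    next
      case 4 then show ?thesis using incompatible_max_cliques \<open>S \<noteq> T\<close> by blast
    qed
  qed
  moreover have "card (?M \<union> ?M') = card ?M + card ?M'"
    by (rule card_Un_disjoint) (use fH HH' in \<open>auto simp: finite_max_cliques\<close>)
  moreover have "card ?M = card (max_cliques ?H E)"
    by (rule card_image, rule inj_onI) (metis HH insert_ident)
  ultimately show ?thesis by (simp add: num_max_cliques_def)
qed

lemma num_max_both_split:
  assumes "finite V" "v \<in> V" "nbrs V E v \<noteq> {}" "nbrs V (- E) v \<noteq> {}"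
  shows "num_max_both (nbrs V E v) E + num_max_both (nbrs V (- E) v) E \<le> num_max_both V E"
  using num_max_cliques_split[of V v E] num_max_cliques_split[of V v "- E"] assms
  by (simp add: num_max_both_def)

text \<open>
  The clique \<open>{v}\<close> is new. With \<open>- E\<close> for \<open>E\<close>, this lemma and the next one are about a vertex
  adjacent to all others.
\<close>

lemma num_max_both_isolated:
  assumes fin: "finite V" and v: "v \<in> V" and ne: "V \<noteq> {v}" and iso: "nbrs V E v = {}"
  shows "Suc (num_max_both (V - {v}) E) \<le> num_max_both V E"
proof (rule num_max_both_delete_Suc[OF fin v])
  show "Suc (num_max_cliques (V - {v}) E) \<le> num_max_cliques V E"
  proof (rule num_max_cliques_delete_Suc[OF fin, of "{v}"])
    fix L assume L: "L \<in> max_cliques (V - {v}) E" "clique (insert v L) E"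
    have "L \<noteq> {}" by (rule max_clique_nonempty[OF L(1)]) (use v ne in blast)
    then show False
      using L(2) max_cliqueD[OF L(1)] iso by (auto simp: nbrs_def clique_insert)
  qed (use v in \<open>auto simp: clique_def\<close>)
qed

lemma has_pair_isolated:
  assumes fin: "finite V" and v: "v \<in> V" and iso: "nbrs V E v = {}"
    and "has_pair m (V - {v}) E"
  shows "has_pair (Suc m) V E"
proof -
  obtain K A where KA: "K \<subseteq> V - {v}" "A \<subseteq> V - {v}" "clique K E" "clique A (- E)"
    "m \<le> card K + card A" using assms(4) unfolding has_pair_def by blast
  have "finite A" "v \<notin> A" using KA fin finite_subset by blast+
  show ?thesis
  proof (rule has_pairI)
    show "clique (insert v A) (- E)" using KA(2,4) iso by (auto simp: clique_insert nbrs_def)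
    show "Suc m \<le> card K + card (insert v A)" using KA \<open>finite A\<close> \<open>v \<notin> A\<close> by simp
  qed (use KA v in auto)
qed

text \<open>
  Let \<open>u\<close> be adjacent to \<open>v\<close> and to all other neighbours of \<open>v\<close>. An anticlique that can be extended by \<open>u\<close> contains no
  neighbour of \<open>v\<close>, so, if it is maximal in \<open>V - {u}\<close>, it contains \<open>v\<close>; but \<open>v\<close> is adjacent to \<open>u\<close>.
  Hence the anticlique \<open>{u}\<close> is new.
\<close>

lemma Suc_num_max_both_if_dominated:
  assumes fin: "finite V" and u: "u \<in> nbrs V E v" and v: "v \<in> V"
    and dom: "\<And>w. w \<in> nbrs V E v \<Longrightarrow> w = u \<or> {w, u} \<in> E"
  shows "Suc (num_max_both (V - {u}) E) \<le> num_max_both V E"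
proof -
  have uV: "u \<in> V" "u \<noteq> v" "{u, v} \<in> E" using u by (auto simp: nbrs_def)
  have "Suc (num_max_cliques (V - {u}) (- E)) \<le> num_max_cliques V (- E)"
  proof (rule num_max_cliques_delete_Suc[OF fin, of "{u}"])
    fix L assume L: "L \<in> max_cliques (V - {u}) (- E)" "clique (insert u L) (- E)"
    have "v \<in> L"
    proof (rule max_clique_mem[OF L(1)])
      fix w assume w: "w \<in> L" "w \<noteq> v"
      then have "w \<in> V" "w \<noteq> u" "{w, u} \<notin> E"
        using max_cliqueD[OF L(1)] L(2) by (auto simp: clique_insert)
      then show "{w, v} \<in> - E" using dom[of w] w(2) by (auto simp: nbrs_def)
    qed (use v uV in auto)
    then show False using L(2) uV by (auto simp: clique_insert insert_commute)
  qed (use uV in \<open>auto simp: clique_def\<close>)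
  then show ?thesis
    using num_max_both_delete_Suc[OF fin uV(1), of "- E"] by simp
qed

text \<open>
  The new clique is \<open>{a, v}\<close>. The common neighbours of \<open>a\<close> and \<open>v\<close> lie in \<open>K\<close>, since \<open>A\<close> is an anticlique, and \<open>x\<close> is
  adjacent to all of them and to \<open>v\<close>. So a maximal clique of \<open>V - {a}\<close> that contains \<open>v\<close> and consists of neighbours
  of \<open>a\<close> would contain \<open>x\<close>, which is not adjacent to \<open>a\<close>.
\<close>

lemma Suc_num_max_both_if_split_nbrs:
  assumes fin: "finite V" and v: "v \<in> V"
    and KA: "nbrs V E v = K \<union> A" "clique K E" "clique A (- E)" "x \<in> K \<inter> A" "a \<in> A" "a \<noteq> x"
  shows "Suc (num_max_both (V - {a}) E) \<le> num_max_both V E"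
proof -
  have aV: "a \<in> V" "a \<noteq> v" "{a, v} \<in> E" and xV: "x \<in> V" "x \<noteq> v" "{x, v} \<in> E"
    using KA by (auto simp: nbrs_def)
  have ax: "{a, x} \<notin> E" using KA cliqueD[of A "- E" a x] by auto
  have "Suc (num_max_cliques (V - {a}) E) \<le> num_max_cliques V E"
  proof (rule num_max_cliques_delete_Suc[OF fin, of "{a, v}"])
    fix L assume L: "L \<in> max_cliques (V - {a}) E" "{a, v} - {a} \<subseteq> L" "clique (insert a L) E"
    have "x \<in> L"
    proof (rule max_clique_mem[OF L(1)])
      fix w assume w: "w \<in> L" "w \<noteq> x"
      have w': "w \<in> V" "w \<noteq> a" "{w, a} \<in> E"
        using w max_cliqueD[OF L(1)] L(3) by (auto simp: clique_insert)
      show "{w, x} \<in> E"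
      proof (cases "w = v")
        case True then show ?thesis using xV by (simp add: insert_commute)
      next
        case False
        then have "{w, v} \<in> E"
          using L(2) aV w max_cliqueD[OF L(1)] by (intro cliqueD[of L E]) auto
        then have "w \<in> K \<union> A" using KA(1) w' False by (auto simp: nbrs_def)
        moreover have "w \<notin> A" using w' cliqueD[OF KA(3), of w a] KA(5) by auto
        ultimately show ?thesis using cliqueD[OF KA(2), of w x] KA(4) w by auto
      qed
    qed (use xV KA in auto)
    then show False using L(3) ax KA(6) by (auto simp: clique_insert insert_commute)
  qed (use aV v in \<open>auto simp: clique_def insert_commute\<close>)
  then show ?thesis by (rule num_max_both_delete_Suc[OF fin aV(1)])
qed

section \<open>Adding a vertex to a clique and an anticlique\<close>

text \<open>
  The vertex set is \<open>K \<union> A\<close> together with one further vertex \<open>v\<close>. Each \<open>a\<close> in the following set gives a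
  clique \<open>{a, v}\<close> that is new with respect to \<open>K \<union> A\<close>. The dual set is \<open>mixed_nbrs A K (- E) v\<close>. If \<open>a \<in> A\<close> is
  a neighbour and \<open>k \<in> K\<close> a non-neighbour of \<open>v\<close>, then \<open>a\<close> is in the first set or \<open>k\<close> is in the dual
  one, depending on whether \<open>a\<close> and \<open>k\<close> are adjacent.
\<close>

definition mixed_nbrs :: "'a set \<Rightarrow> 'a set \<Rightarrow> 'a set set \<Rightarrow> 'a \<Rightarrow> 'a set" where
  "mixed_nbrs K A E v = {a \<in> A. {a, v} \<in> E \<and> (\<exists>k\<in>K. {k, v} \<notin> E \<and> {a, k} \<in> E)}"

text \<open>
  All neighbours of \<open>a\<close> in \<open>K \<union> A\<close> lie in \<open>K\<close>, so the only maximal clique through \<open>a\<close> consists of \<open>a\<close> and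
  its neighbours in \<open>K\<close>. The two sets may share a vertex.
\<close>

lemma max_clique_through_anticlique:
  assumes L: "L \<in> max_cliques (K \<union> A) E" "a \<in> L" "a \<in> A"
    and KA: "clique K E" "clique A (- E)" and k: "k \<in> K" "{a, k} \<in> E"
  shows "k \<in> L"
proof (rule max_clique_mem[OF L(1)])
  fix u assume u: "u \<in> L" "u \<noteq> k"
  show "{u, k} \<in> E"
  proof (cases "u = a")
    case False
    then have "{u, a} \<in> E" using cliqueD max_cliqueD[OF L(1)] u L(2) by metis
    then have "u \<notin> A" using cliqueD[OF KA(2), of u a] L(3) False by auto
    then have "u \<in> K" using u max_cliqueD[OF L(1)] by blast
    then show ?thesis using cliqueD[OF KA(1)] u k by blast
  qed (use k in simp)
qed (use k in blast)

text \<open>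
  Besides the cliques \<open>{a, v}\<close> there is one more candidate: \<open>v\<close> with its neighbours in \<open>K\<close>. If \<open>v\<close> has a
  non-neighbour in \<open>K\<close>, it fails to be new only if some neighbour of \<open>v\<close> in \<open>A\<close> is adjacent to all of these
  neighbours; this is the second statement.
\<close>

lemma num_max_cliques_delete_split:
  assumes fin: "finite V" and V: "V = insert v (K \<union> A)" "v \<notin> K \<union> A"
    and KA: "clique K E" "clique A (- E)"
  shows num_max_cliques_delete_mixed:
      "num_max_cliques (V - {v}) E + card (mixed_nbrs K A E v) \<le> num_max_cliques V E"
    and num_max_cliques_delete_mixed_eqD:
      "\<lbrakk>num_max_cliques V E \<le> num_max_cliques (V - {v}) E + card (mixed_nbrs K A E v);
        k \<in> K; {k, v} \<notin> E\<rbrakk>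
       \<Longrightarrow> \<exists>a\<in>A. {a, v} \<in> E \<and> (\<forall>k\<in>K. {k, v} \<in> E \<longrightarrow> k = a \<or> {k, a} \<in> E)"
proof -
  let ?P = "mixed_nbrs K A E v"
  let ?F = "(\<lambda>a. {a, v}) ` ?P"
  have Vv: "V - {v} = K \<union> A" using V by blast
  have vV: "v \<in> V" using V by blast
  have P: "a \<in> A" "a \<in> V" "a \<noteq> v" "{a, v} \<in> E" if "a \<in> ?P" for a
    using that V by (auto simp: mixed_nbrs_def)
  have finP: "finite ?P" using fin V finite_subset[of ?P V] by (auto simp: mixed_nbrs_def)
  have cardF: "card ?F = card ?P"
    by (rule card_image) (use P(3) in \<open>auto simp: inj_on_def doubleton_eq_iff\<close>)
  have F: "S \<subseteq> V \<and> v \<in> S \<and> clique S E" if "S \<in> ?F" for S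
    using that P vV by (auto simp: clique_def insert_commute)
  have incF: "\<not> clique (S \<union> T) E" if "S \<in> ?F" "T \<in> ?F" "S \<noteq> T" for S T
  proof
    assume cl: "clique (S \<union> T) E"
    obtain a b where "S = {a, v}" "T = {b, v}" "a \<in> ?P" "b \<in> ?P" "a \<noteq> b"
      using \<open>S \<in> ?F\<close> \<open>T \<in> ?F\<close> \<open>S \<noteq> T\<close> by blast
    then show False
      using cliqueD[OF cl, of a b] cliqueD[OF KA(2), of a b] P(1) by auto
  qed
  have lonelyF: False if S: "S \<in> ?F" and L: "L \<in> max_cliques (V - {v}) E" "S - {v} \<subseteq> L"
    "clique (insert v L) E" for S L
  proof -
    obtain a k where a: "a \<in> ?P" "S = {a, v}" "k \<in> K" "{k, v} \<notin> E" "{a, k} \<in> E"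
      using S by (auto simp: mixed_nbrs_def)
    have "a \<in> L" using L(2) a(2) P(3)[OF a(1)] by blast
    then have "k \<in> L"
      using max_clique_through_anticlique[of L K A E a k] L(1) a(3,5) KA P(1)[OF a(1)] Vv by simp
    moreover have "k \<noteq> v" using V a by blast
    ultimately show False using L(3) a(4) by (auto simp: clique_insert)
  qed
  show "num_max_cliques (V - {v}) E + card ?P \<le> num_max_cliques V E"
    unfolding cardF[symmetric] by (rule num_max_cliques_delete[OF fin vV F incF lonelyF])
  show "\<exists>a\<in>A. {a, v} \<in> E \<and> (\<forall>k\<in>K. {k, v} \<in> E \<longrightarrow> k = a \<or> {k, a} \<in> E)"
    if le: "num_max_cliques V E \<le> num_max_cliques (V - {v}) E + card ?P"
      and k: "k \<in> K" "{k, v} \<notin> E"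
  proof (rule ccontr)
    assume none: "\<not> ?thesis"
    \<comment> \<open>\<open>S0\<close> is a further new clique, which contradicts the assumed upper bound.\<close>
    define S0 where "S0 = insert v {k \<in> K. {k, v} \<in> E}"
    have notin: "\<not> clique (S0 \<union> {a, v}) E" if "a \<in> ?P" for a
    proof
      assume cl: "clique (S0 \<union> {a, v}) E"
      have "k = a \<or> {k, a} \<in> E" if "k \<in> K" "{k, v} \<in> E" for k
        using cliqueD[OF cl, of k a] that unfolding S0_def by blast
      then show False using none P \<open>a \<in> ?P\<close> by blast
    qed
    have "clique {k \<in> K. {k, v} \<in> E} E" by (rule smaller_clique[OF KA(1)]) blast
    then have "clique S0 E" unfolding S0_def clique_insert by blast
    then have S0: "S0 \<subseteq> V \<and> v \<in> S0 \<and> clique S0 E"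
      using V(1) unfolding S0_def by blast
    have "S0 \<notin> ?F"
    proof
      assume "S0 \<in> ?F"
      then obtain a where "a \<in> ?P" "S0 = {a, v}" by blast
      then show False using notin S0 by (metis Un_absorb)
    qed
    have lonely0: False if L: "L \<in> max_cliques (V - {v}) E" "S0 - {v} \<subseteq> L" "clique (insert v L) E"
      for L
    proof (cases "L \<inter> A = {}")
      case True
      then have "L \<subseteq> K" using max_cliqueD[OF L(1)] Vv by blast
      then have "K = L" by (rule max_clique_eq[OF L(1)]) (use KA(1) Vv in auto)
      moreover have "k \<noteq> v" using k V by blast
      ultimately show False using L(3) k by (auto simp: clique_insert)
    next
      case False
      then obtain a where a: "a \<in> L" "a \<in> A" by blast
      then have "a \<noteq> v" using V by blast
      then have av: "{a, v} \<in> E" using L(3) a by (auto simp: clique_insert)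
      have "k = a \<or> {k, a} \<in> E" if "k \<in> K" "{k, v} \<in> E" for k
      proof -
        have "k \<in> L" using that L(2) V by (auto simp: S0_def)
        then show ?thesis using cliqueD max_cliqueD[OF L(1)] a by metis
      qed
      then show False using none a av by blast
    qed
    have "num_max_cliques (V - {v}) E + card (insert S0 ?F) \<le> num_max_cliques V E"
    proof (rule num_max_cliques_delete[OF fin vV])
      fix S T assume ST: "S \<in> insert S0 ?F" "T \<in> insert S0 ?F" "S \<noteq> T"
      consider "S \<in> ?F" "T \<in> ?F" | "S = S0" "T \<in> ?F" | "T = S0" "S \<in> ?F"
        using ST unfolding insert_iff by metis
      then show "\<not> clique (S \<union> T) E"
      proof cases
        case 1 then show ?thesis using incF ST(3) by metis
      next
        case 2
        then obtain a where "a \<in> ?P" "T = {a, v}" by blast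
        then show ?thesis using notin[of a] 2 by simp
      next
        case 3
        then obtain a where "a \<in> ?P" "S = {a, v}" by blast
        then show ?thesis using notin[of a] 3 by (metis Un_commute)
      qed
    next
      fix S assume "S \<in> insert S0 ?F"
      then show "S \<subseteq> V \<and> v \<in> S \<and> clique S E" using F S0 unfolding insert_iff by metis
    next
      fix S L assume "S \<in> insert S0 ?F" and L: "L \<in> max_cliques (V - {v}) E" "S - {v} \<subseteq> L"
        "clique (insert v L) E"
      then consider "S = S0" | "S \<in> ?F" unfolding insert_iff by fast
      then show False
      proof cases
        case 1 then show ?thesis using lonely0 L by simp
      next
        case 2 then show ?thesis by (rule lonelyF[OF _ L])
      qed
    qed
    moreover have "card (insert S0 ?F) = Suc (card ?P)"
      using card_insert_disjoint[OF finite_imageI[OF finP] \<open>S0 \<notin> ?F\<close>] cardF by metis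
    ultimately show False using le by linarith
  qed
qed

text \<open>
  The exchange that enlarges the anticlique: \<open>a\<close> is the only neighbour of \<open>v\<close> in \<open>A\<close>, and \<open>k\<close> has no neighbour
  in \<open>A - {a}\<close>, so \<open>a\<close> can be replaced by both \<open>k\<close> and \<open>v\<close>.
\<close>

lemma has_pair_swap:
  assumes fin: "finite V" and V: "V = insert v (K \<union> A)" "v \<notin> K \<union> A"
    and KA: "clique K E" "clique A (- E)"
    and a: "a \<in> A" "\<And>b. \<lbrakk>b \<in> A; {b, v} \<in> E\<rbrakk> \<Longrightarrow> b = a"
    and k: "k \<in> K" "{k, v} \<notin> E" "{k, a} \<in> E" "k \<noteq> a"
    and dom: "\<And>b. \<lbrakk>b \<in> A; {b, v} \<notin> E\<rbrakk> \<Longrightarrow> b = k \<or> {b, k} \<notin> E"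
  shows "has_pair (Suc (card K + card A)) V E"
proof (rule has_pairI)
  let ?A = "insert v (insert k (A - {a}))"
  have "k \<notin> A" using KA(2) a k cliqueD[of A "- E" k a] by auto
  moreover have "finite A" using fin V by simp
  moreover have "v \<noteq> k" using V k by blast
  ultimately have "card ?A = Suc (Suc (card (A - {a})))" using V by simp
  also have "\<dots> = Suc (card A)" using card_Suc_Diff1[OF \<open>finite A\<close> a(1)] by simp
  finally have "card ?A = Suc (card A)" .
  then show "Suc (card K + card A) \<le> card K + card ?A" by simp
  show "clique ?A (- E)"
    using a k dom smaller_clique[OF KA(2), of "A - {a}"]
    by (auto simp: clique_insert insert_commute)
qed (use V k KA in auto)

text \<open>
  Unless \<open>K\<close> or \<open>A\<close> can be extended by \<open>v\<close>, there are a non-neighbour of \<open>v\<close> in \<open>K\<close> and a neighbour in \<open>A\<close>,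
  and these give a new clique or a new anticlique. If that is the only gain, neither of the two additional
  candidates is new. This provides \<open>a\<close> and \<open>k\<close> for the exchange of the previous lemma or its dual, depending
  on whether \<open>a\<close> and \<open>k\<close> are adjacent.
\<close>

lemma split_plus_vertex:
  assumes fin: "finite V" and V: "V = insert v (K \<union> A)" "v \<notin> K \<union> A"
    and KA: "clique K E" "clique A (- E)"
  shows "num_max_both (V - {v}) E + 2 \<le> num_max_both V E \<or> has_pair (Suc (card K + card A)) V E"
proof (rule disjCI)
  assume no: "\<not> has_pair (Suc (card K + card A)) V E"
  show "num_max_both (V - {v}) E + 2 \<le> num_max_both V E"
  proof (rule ccontr)
    assume less: "\<not> ?thesis"
    let ?P = "mixed_nbrs K A E v" and ?Q = "mixed_nbrs A K (- E) v"
    have finK: "finite K" "finite A" using fin V by simp_all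
    have V': "V = insert v (A \<union> K)" "v \<notin> A \<union> K" using V by auto
    have KA': "clique A (- E)" "clique K (- (- E))" using KA by simp_all
    have "\<exists>k\<in>K. {k, v} \<notin> E"
    proof (rule ccontr)
      assume "\<not> ?thesis"
      then have "clique (insert v K) E" using KA by (auto simp: clique_insert)
      then have "has_pair (Suc (card K + card A)) V E"
        by (rule has_pairI[rotated 2]) (use V KA finK in auto)
      then show False using no by simp
    qed
    then obtain k1 where k1: "k1 \<in> K" "{k1, v} \<notin> E" by blast
    have "\<exists>a\<in>A. {a, v} \<in> E"
    proof (rule ccontr)
      assume "\<not> ?thesis"
      then have "clique (insert v A) (- E)" using KA by (auto simp: clique_insert)
      then have "has_pair (Suc (card K + card A)) V E"
        by (rule has_pairI[rotated 3]) (use V KA finK in auto)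
      then show False using no by simp
    qed
    then obtain a1 where a1: "a1 \<in> A" "{a1, v} \<in> E" by blast
    have fPQ: "finite ?P" "finite ?Q" using finK by (simp_all add: mixed_nbrs_def)
    have pair: "a \<in> ?P \<or> k \<in> ?Q" if "a \<in> A" "{a, v} \<in> E" "k \<in> K" "{k, v} \<notin> E" for a k
      using that by (auto simp: mixed_nbrs_def insert_commute)
    have "?P \<noteq> {} \<or> ?Q \<noteq> {}" using pair a1 k1 by blast
    then have "1 \<le> card ?P + card ?Q" using fPQ by (metis One_nat_def Suc_leI add_gr_0 card_gt_0_iff)
    then have cards: "card ?P + card ?Q = 1"
      and eqs: "num_max_cliques V E \<le> num_max_cliques (V - {v}) E + card ?P"
      "num_max_cliques V (- E) \<le> num_max_cliques (V - {v}) (- E) + card ?Q"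
      using less num_max_cliques_delete_mixed[OF fin V KA] num_max_cliques_delete_mixed[OF fin V' KA']
      by (auto simp: num_max_both_def)
    obtain a where a: "a \<in> A" "{a, v} \<in> E" "\<forall>k\<in>K. {k, v} \<in> E \<longrightarrow> k = a \<or> {k, a} \<in> E"
      using num_max_cliques_delete_mixed_eqD[OF fin V KA eqs(1) k1] by blast
    obtain k where k: "k \<in> K" "{k, v} \<notin> E" "\<forall>a\<in>A. {a, v} \<notin> E \<longrightarrow> a = k \<or> {a, k} \<notin> E"
      using num_max_cliques_delete_mixed_eqD[OF fin V' KA' eqs(2), of a1] a1 by auto
    have "k \<noteq> a" using a k by blast
    have "has_pair (Suc (card K + card A)) V E"
    proof (cases "{k, a} \<in> E")
      case True
      then have "a \<in> ?P"
        using a(1,2) k(1,2) unfolding mixed_nbrs_def by (auto simp: insert_commute)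
      then have "0 < card ?P" using fPQ by (auto simp: card_gt_0_iff)
      then have "card ?P = 1" "card ?Q = 0" using cards by linarith+
      then have "?Q = {}" using fPQ by simp
      have "?P = {a}" using \<open>card ?P = 1\<close> \<open>a \<in> ?P\<close> by (metis card_1_singletonE singletonD)
      then have "\<And>b. \<lbrakk>b \<in> A; {b, v} \<in> E\<rbrakk> \<Longrightarrow> b = a"
        using pair k1 \<open>?Q = {}\<close> by blast
      then show ?thesis
        by (intro has_pair_swap[OF fin V KA, of a k]) (use a(1) k True \<open>k \<noteq> a\<close> in blast)+
    next
      case False
      then have "k \<in> ?Q"
        using a(1,2) k(1,2) unfolding mixed_nbrs_def by (auto simp: insert_commute)
      then have "0 < card ?Q" using fPQ by (auto simp: card_gt_0_iff)
      then have "card ?Q = 1" "card ?P = 0" using cards by linarith+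
      then have "?P = {}" using fPQ by simp
      have "?Q = {k}" using \<open>card ?Q = 1\<close> \<open>k \<in> ?Q\<close> by (metis card_1_singletonE singletonD)
      then have "\<And>b. \<lbrakk>b \<in> K; {b, v} \<in> - E\<rbrakk> \<Longrightarrow> b = k"
        using pair a1 \<open>?P = {}\<close> by blast
      then have "has_pair (Suc (card A + card K)) V (- E)"
        by (intro has_pair_swap[OF fin V' KA', of k a])
          (use a k(1) False \<open>k \<noteq> a\<close> in \<open>simp_all add: insert_commute\<close>)
      then show ?thesis by (simp add: add.commute)
    qed
    then show False using no by simp
  qed
qed

text \<open>
  The shared vertex \<open>x\<close> already contributes the new clique \<open>{x, y}\<close>. If \<open>y\<close> has no other neighbour in \<open>A\<close>, it can
  replace \<open>x\<close> there. Otherwise let \<open>a\<close> be such a neighbour; a non-neighbour of \<open>y\<close> in \<open>K\<close> provides, together with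
  \<open>a\<close>, a second gain. Gains are limited to 2, so there is no third one, and all neighbours of \<open>k\<close> in
  \<open>A\<close> are neighbours of \<open>y\<close>, for a suitable \<open>k\<close>. If \<open>a\<close> and \<open>k\<close> are adjacent, \<open>x\<close>, \<open>k\<close>, \<open>a\<close>, \<open>y\<close> form an induced
  4-cycle in this order. Otherwise \<open>y\<close> can replace \<open>k\<close> in \<open>K\<close> while \<open>k\<close> replaces \<open>x\<close> in \<open>A\<close>.
\<close>

lemma split_plus_vertex_structure:
  assumes fin: "finite V" and V: "V = insert y (K \<union> A)" "y \<notin> K \<union> A"
    and KA: "clique K E" "clique A (- E)" and x: "x \<in> K" "x \<in> A" "{x, y} \<in> E"
    and no: "\<not> has_pair (Suc (card K + card A)) V E"
    and few: "num_max_both V E \<le> num_max_both (V - {y}) E + 2"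
  obtains (partition) K' A' where "clique K' E" "clique A' (- E)" "K' \<union> A' = V"
      "card K' + card A' = card K + card A"
  | (four_cycle) k a where "k \<in> K" "a \<in> A" "{k, y} \<notin> E" "a \<noteq> x"
      "\<And>b. b \<in> A \<Longrightarrow> {b, y} \<in> E \<longleftrightarrow> b = x \<or> b = a"
      "\<And>b. b \<in> A \<Longrightarrow> {b, k} \<in> E \<longleftrightarrow> b = x \<or> b = a"
proof -
  let ?P = "mixed_nbrs K A E y" and ?Q = "mixed_nbrs A K (- E) y"
  have finK: "finite K" "finite A" using fin V by simp_all
  have V': "V = insert y (A \<union> K)" "y \<notin> A \<union> K" using V by auto
  have KA': "clique A (- E)" "clique K (- (- E))" using KA by simp_all
  have fPQ: "finite ?P" "finite ?Q" using finK by (simp_all add: mixed_nbrs_def)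
  have "\<exists>k\<in>K. {k, y} \<notin> E"
  proof (rule ccontr)
    assume "\<not> ?thesis"
    then have "clique (insert y K) E" using KA by (auto simp: clique_insert)
    then have "has_pair (Suc (card K + card A)) V E"
      by (rule has_pairI[rotated 2]) (use V KA finK in auto)
    then show False using no by simp
  qed
  then obtain k1 where k1: "k1 \<in> K" "{k1, y} \<notin> E" by blast
  have KA_int: "k \<notin> A" "k \<noteq> x" if "k \<in> K" "{k, y} \<notin> E" for k
    using that x clique_Int_anticlique[OF KA, of k x] by blast+
  have xP: "x \<in> ?P"
    using x k1 KA_int(2)[OF k1] cliqueD[OF KA(1), of x k1] by (auto simp: mixed_nbrs_def)
  have pair: "a \<in> ?P \<or> k \<in> ?Q" if "a \<in> A" "{a, y} \<in> E" "k \<in> K" "{k, y} \<notin> E" for a k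
    using that by (auto simp: mixed_nbrs_def insert_commute)
  show thesis
  proof (cases "\<exists>a\<in>A. a \<noteq> x \<and> {a, y} \<in> E")
    case False
    show thesis
    proof (rule partition[of K "insert y (A - {x})"])
      show "clique (insert y (A - {x})) (- E)"
        using False smaller_clique[OF KA(2), of "A - {x}"] by (auto simp: clique_insert)
      show "card K + card (insert y (A - {x})) = card K + card A"
        using V card_Suc_Diff1[OF finK(2) x(2)] finK by simp
    qed (use V x KA in auto)
  next
    case True
    then obtain a where a: "a \<in> A" "a \<noteq> x" "{a, y} \<in> E" by blast
    have two: "2 \<le> card ?P + card ?Q"
    proof (cases "a \<in> ?P")
      case True
      then have "card {x, a} \<le> card ?P" using xP fPQ by (intro card_mono) auto
      then show ?thesis using a by auto
    next
      case False
      then have "k1 \<in> ?Q" using pair a k1 by blast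
      then have "0 < card ?P" "0 < card ?Q" using xP fPQ by (auto simp: card_gt_0_iff)
      then show ?thesis by simp
    qed
    then have cards: "card ?P + card ?Q = 2"
      and "num_max_cliques V (- E) \<le> num_max_cliques (V - {y}) (- E) + card ?Q"
      using few num_max_cliques_delete_mixed[OF fin V KA] num_max_cliques_delete_mixed[OF fin V' KA']
      by (auto simp: num_max_both_def)
    then obtain k where k: "k \<in> K" "{k, y} \<notin> E" "\<forall>b\<in>A. {b, y} \<notin> E \<longrightarrow> b = k \<or> {b, k} \<notin> E"
      using num_max_cliques_delete_mixed_eqD[OF fin V' KA', of x] x by auto
    have kA: "k \<notin> A" "k \<noteq> x" using KA_int k by blast+
    show thesis
    proof (cases "{a, k} \<in> E")
      case True
      then have aP: "a \<in> ?P" using a k by (auto simp: mixed_nbrs_def)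
      have "{x, a} \<subseteq> ?P" "card {x, a} = 2" using aP xP a by auto
      then have "card ?P = 2" "card ?Q = 0"
        using cards card_mono[OF fPQ(1), of "{x, a}"] by linarith+
      then have P: "?P = {x, a}" "?Q = {}"
        using card_subset_eq[OF fPQ(1) \<open>{x, a} \<subseteq> ?P\<close>] \<open>card {x, a} = 2\<close> fPQ by auto
      have y_iff: "{b, y} \<in> E \<longleftrightarrow> b = x \<or> b = a" if "b \<in> A" for b
        using pair[OF that _ k1] P that x a by blast
      show thesis
      proof (rule four_cycle[of k a])
        fix b assume b: "b \<in> A"
        show "{b, y} \<in> E \<longleftrightarrow> b = x \<or> b = a" by (rule y_iff[OF b])
        have "b \<noteq> k" using b kA by blast
        then show "{b, k} \<in> E \<longleftrightarrow> b = x \<or> b = a"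
          using b k(3) y_iff[OF b] True cliqueD[OF KA(1), of x k] x(1) k(1) kA by auto
      qed (use k a in auto)
    next
      case False
      then have kQ: "k \<in> ?Q" using a k by (auto simp: mixed_nbrs_def insert_commute)
      then have "0 < card ?P" "0 < card ?Q" using xP fPQ by (auto simp: card_gt_0_iff)
      then have "card ?P = 1" "card ?Q = 1" using cards by linarith+
      then have P: "?P = {x}" "?Q = {k}" using xP kQ by (metis card_1_singletonE singletonD)+
      have aP: "a \<notin> ?P" using P a by blast
      have Q1: "h = k" if "h \<in> K" "{h, y} \<notin> E" for h
        using pair[OF a(1,3) that] P aP by blast
      have nk: "{b, k} \<notin> E" if "b \<in> A" "b \<noteq> x" for b
      proof
        assume "{b, k} \<in> E"
        then have "{b, y} \<in> E" using k(3) that kA by blast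
        then have "b \<in> ?P" using that k \<open>{b, k} \<in> E\<close> by (auto simp: mixed_nbrs_def)
        then show False using P that by blast
      qed
      show thesis
      proof (rule partition[of "insert y (K - {k})" "insert k (A - {x})"])
        show "clique (insert y (K - {k})) E"
          using Q1 smaller_clique[OF KA(1), of "K - {k}"] by (auto simp: clique_insert)
        show "clique (insert k (A - {x})) (- E)"
          using nk smaller_clique[OF KA(2), of "A - {x}"] by (auto simp: clique_insert)
        show "card (insert y (K - {k})) + card (insert k (A - {x})) = card K + card A"
          using V kA card_Suc_Diff1[OF finK(1) k(1)] card_Suc_Diff1[OF finK(2) x(2)] finK by simp
      qed (use V x k kA in auto)
    qed
  qed
qed

section \<open>The exceptional 4-cycle\<close>

text \<open>
  On the cycle \<open>x\<close>, \<open>k\<close>, \<open>a\<close>, \<open>y\<close>, the clique \<open>{x, y}\<close> is new with respect to \<open>V - {y}\<close> as soon as the common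
  neighbours of \<open>x\<close> and \<open>y\<close> are adjacent to \<open>k\<close>, since \<open>k\<close> is not adjacent to \<open>y\<close>; similarly \<open>{a, y}\<close>. Only
  \<open>v\<close> can violate this. There is a symmetry that exchanges \<open>y\<close> with \<open>a\<close> and \<open>x\<close> with \<open>k\<close> and replaces \<open>A\<close>
  by the anticlique obtained from it by exchanging \<open>x\<close>, \<open>a\<close> for \<open>k\<close>, \<open>y\<close>; accordingly, when \<open>v\<close> is adjacent to \<open>x\<close>,
  the vertex \<open>a\<close> has two new cliques \<open>{k, a}\<close> and \<open>{y, a}\<close>. What remains is \<open>v\<close> adjacent to \<open>a\<close> and \<open>y\<close> but not
  to \<open>x\<close> and \<open>k\<close>; then the anticliques \<open>{x, v}\<close> and \<open>{k, v}\<close> are new with respect to \<open>V - {v}\<close>.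
\<close>

lemma delete_two_at_four_cycle:
  assumes fin: "finite V" and V: "V = insert v (insert y (K \<union> A))"
    and new: "v \<noteq> y" "v \<notin> K \<union> A" "y \<notin> K \<union> A"
    and KA: "clique K E" "clique A (- E)" and x: "x \<in> K" "x \<in> A" "{x, y} \<in> E"
    and ka: "k \<in> K" "a \<in> A" "{k, y} \<notin> E" "a \<noteq> x"
    and y_iff: "\<And>b. b \<in> A \<Longrightarrow> {b, y} \<in> E \<longleftrightarrow> b = x \<or> b = a"
    and k_iff: "\<And>b. b \<in> A \<Longrightarrow> {b, k} \<in> E \<longleftrightarrow> b = x \<or> b = a"
  shows "\<exists>u\<in>V. num_max_both (V - {u}) E + 2 \<le> num_max_both V E"
proof -
  have ne: "k \<noteq> x" "k \<notin> A" "a \<notin> K" "k \<noteq> a"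
    using x ka clique_Int_anticlique[OF KA, of _ x] by blast+
  have dist: "y \<noteq> x" "y \<noteq> a" "y \<noteq> k" "v \<noteq> x" "v \<noteq> a" "v \<noteq> k" using new x ka by blast+
  have inV: "v \<in> V" "y \<in> V" "x \<in> V" "a \<in> V" "k \<in> V" using V x ka by blast+
  have ay: "{a, y} \<in> E" and ak: "{a, k} \<in> E" and xk: "{x, k} \<in> E"
    using y_iff k_iff x ka by blast+
  have xa: "{x, a} \<notin> E" using cliqueD[OF KA(2), of x a] x ka by blast
  have K_adj: "{u, w} \<in> E" if "u \<in> K" "w \<in> K" "u \<noteq> w" for u w using cliqueD[OF KA(1)] that .
  have A_nadj: "{u, w} \<notin> E" if "u \<in> A" "w \<in> A" "u \<noteq> w" for u w
    using cliqueD[OF KA(2)] that by blast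
  consider (y) "{v, k} \<in> E \<or> {v, x} \<notin> E \<and> ({v, a} \<notin> E \<or> {v, y} \<notin> E)"
    | (a) "{v, x} \<in> E" | (v) "{v, k} \<notin> E" "{v, x} \<notin> E" "{v, a} \<in> E" "{v, y} \<in> E"
    by blast
  then show ?thesis
  proof cases
    case y
    have "num_max_both (V - {y}) E + 2 \<le> num_max_both V E"
    proof (rule num_max_both_delete_two[OF fin, of y x a])
      fix L assume L: "L \<in> max_cliques (V - {y}) E" "clique (insert y L) E"
      have sub: "L \<subseteq> V - {y}" "clique L E" using max_cliqueD[OF L(1)] by blast+
      have Ly: "{u, y} \<in> E" if "u \<in> L" for u
        using L(2) that sub(1) unfolding clique_insert by blast
      have False if "s \<in> L" "s = x \<or> s = a" for s
      proof -
        have "k \<in> L"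
        proof (rule max_clique_mem[OF L(1)])
          fix u assume u: "u \<in> L" "u \<noteq> k"
          have us: "u = s \<or> {u, s} \<in> E" using cliqueD[OF sub(2) u(1) that(1)] by blast
          consider "u = v" | "u \<in> K" | "u \<in> A" using u sub(1) V by blast
          then show "{u, k} \<in> E"
          proof cases
            case 1
            then have "{v, s} \<in> E" "{v, y} \<in> E" using us Ly[OF u(1)] that(2) dist by auto
            then show ?thesis using y that(2) 1 by blast
          next
            case 2 then show ?thesis using K_adj u ka by blast
          next
            case 3
            then have "u = s" using us A_nadj[of u s] that(2) x ka by blast
            then show ?thesis using that(2) xk ak by blast
          qed
        qed (use inV dist in blast)
        then show False using Ly ka by blast
      qed
      then show "x \<in> L \<Longrightarrow> False" "a \<in> L \<Longrightarrow> False" by blast+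
    qed (use inV x ay xa dist ka in auto)
    then show ?thesis using inV by blast
  next
    case a
    have "num_max_both (V - {a}) E + 2 \<le> num_max_both V E"
    proof (rule num_max_both_delete_two[OF fin, of a k y])
      fix L assume L: "L \<in> max_cliques (V - {a}) E" "clique (insert a L) E"
      have sub: "L \<subseteq> V - {a}" "clique L E" using max_cliqueD[OF L(1)] by blast+
      have La: "{u, a} \<in> E" if "u \<in> L" for u
        using L(2) that sub(1) unfolding clique_insert by blast
      have False if "s \<in> L" "s = k \<or> s = y" for s
      proof -
        have "x \<in> L"
        proof (rule max_clique_mem[OF L(1)])
          fix u assume u: "u \<in> L" "u \<noteq> x"
          have us: "u = s \<or> {u, s} \<in> E" using cliqueD[OF sub(2) u(1) that(1)] by blast
          consider "u = v" | "u = y" | "u \<in> K" | "u \<in> A" using u sub(1) V by blast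
          then show "{u, x} \<in> E"
          proof cases
            case 1 then show ?thesis using a by simp
          next
            case 2 then show ?thesis using x(3) by (simp add: insert_commute)
          next
            case 3 then show ?thesis using K_adj u x by blast
          next
            case 4
            then have "{u, s} \<in> E" using us that(2) ne new by blast
            then have "u = x \<or> u = a" using y_iff[OF 4] k_iff[OF 4] that(2) by blast
            then show ?thesis using u sub(1) by blast
          qed
        qed (use inV ka in blast)
        then show False using La xa by blast
      qed
      then show "k \<in> L \<Longrightarrow> False" "y \<in> L \<Longrightarrow> False" by blast+
    qed (use inV ay ak dist ne ka in \<open>auto simp: insert_commute\<close>)
    then show ?thesis using inV by blast
  next
    case v
    have "num_max_both (V - {v}) (- E) + 2 \<le> num_max_both V (- E)"
    proof (rule num_max_both_delete_two[OF fin, of v x k])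
      fix L assume L: "L \<in> max_cliques (V - {v}) (- E)" "clique (insert v L) (- E)"
      have sub: "L \<subseteq> V - {v}" "clique L (- E)" using max_cliqueD[OF L(1)] by blast+
      have Lv: "{v, u} \<notin> E" if "u \<in> L" for u
        using cliqueD[OF L(2), of v u] that sub(1) by blast
      have L_nadj: "{u, w} \<notin> E" if "u \<in> L" "w \<in> L" "u \<noteq> w" for u w
        using cliqueD[OF sub(2)] that by blast
      show False if "x \<in> L"
      proof -
        have "a \<in> L"
        proof (rule max_clique_mem[OF L(1)])
          fix u assume u: "u \<in> L" "u \<noteq> a"
          consider "u = y" | "u \<in> K" | "u \<in> A" using u sub(1) V by blast
          then show "{u, a} \<in> - E"
          proof cases
            case 1 then show ?thesis using L_nadj[of x y] that u x dist by auto
          next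
            case 2
            then have "u = x" using K_adj[of u x] L_nadj[of u x] u that x by blast
            then show ?thesis using xa by simp
          next
            case 3 then show ?thesis using A_nadj u ka by blast
          qed
        qed (use inV dist in blast)
        then show False using Lv v by blast
      qed
      show False if "k \<in> L"
      proof -
        have "y \<in> L"
        proof (rule max_clique_mem[OF L(1)])
          fix u assume u: "u \<in> L" "u \<noteq> y"
          consider "u \<in> K" | "u \<in> A" using u sub(1) V by blast
          then show "{u, y} \<in> - E"
          proof cases
            case 1
            then have "u = k" using K_adj[of u k] L_nadj[of u k] u that ka by blast
            then show ?thesis using ka by simp
          next
            case 2
            then have "u \<noteq> k" using ne by blast
            then have "{u, k} \<notin> E" using L_nadj u that by blast
            then show ?thesis using y_iff[OF 2] k_iff[OF 2] by blast
          qed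
        qed (use inV new in blast)
        then show False using Lv v by blast
      qed
    qed (use inV xk dist ne v in \<open>auto simp: insert_commute\<close>)
    then show ?thesis using inV by auto
  qed
qed

section \<open>The induction\<close>

lemma card_Un_clique_anticlique:
  assumes "finite K" "finite A" "clique K E" "clique A (- E)"
  obtains (disjoint) "card K + card A = card (K \<union> A)"
  | (meet) x where "x \<in> K" "x \<in> A" "card K + card A = Suc (card (K \<union> A))"
proof (cases "K \<inter> A = {}")
  case True
  then show thesis using disjoint card_Un_Int[OF assms(1,2)] by simp
next
  case False
  then obtain x where x: "x \<in> K \<inter> A" by blast
  then have "K \<inter> A = {x}" using clique_Int_anticlique[OF assms(3,4) _ x] by blast
  then have "card K + card A = Suc (card (K \<union> A))" using card_Un_Int[OF assms(1,2)] by simp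
  then show thesis using meet x by blast
qed

lemma has_pair_full:
  assumes fin: "finite U" and "has_pair (Suc (card U)) U E"
  obtains K A x where "clique K E" "clique A (- E)" "K \<union> A = U" "x \<in> K" "x \<in> A"
    "card K + card A = Suc (card U)"
proof -
  obtain K A where KA: "K \<subseteq> U" "A \<subseteq> U" "clique K E" "clique A (- E)"
    "Suc (card U) \<le> card K + card A" using assms(2) unfolding has_pair_def by blast
  have sub: "K \<union> A \<subseteq> U" and fKA: "finite K" "finite A" using KA fin finite_subset by blast+
  then have le: "card (K \<union> A) \<le> card U" using fin by (simp add: card_mono)
  show thesis
  proof (rule card_Un_clique_anticlique[OF fKA KA(3,4)])
    assume "card K + card A = card (K \<union> A)"
    then show thesis using KA(5) le by linarith
  next
    fix x assume x: "x \<in> K" "x \<in> A" "card K + card A = Suc (card (K \<union> A))"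
    then have "card (K \<union> A) = card U" using KA(5) le by linarith
    then have "K \<union> A = U" using card_subset_eq[OF fin sub] by blast
    then show thesis using that[of K A x] KA x by simp
  qed
qed

lemma has_pair_all_but_one:
  assumes fin: "finite U" and "has_pair (card U) U E"
  obtains (cover) K A where "clique K E" "clique A (- E)" "K \<union> A = U"
    "card U \<le> card K + card A"
  | (leftover) K A x y where "clique K E" "clique A (- E)" "U = insert y (K \<union> A)" "y \<notin> K \<union> A"
    "x \<in> K" "x \<in> A" "card K + card A = card U"
proof -
  obtain K A where KA: "K \<subseteq> U" "A \<subseteq> U" "clique K E" "clique A (- E)"
    "card U \<le> card K + card A" using assms(2) unfolding has_pair_def by blast
  have sub: "K \<union> A \<subseteq> U" and fKA: "finite K" "finite A" using KA fin finite_subset by blast+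
  show thesis
  proof (cases "K \<union> A = U")
    case True then show thesis using cover KA by blast
  next
    case False
    then have psub: "K \<union> A \<subset> U" using sub by blast
    then have less: "card (K \<union> A) < card U" using fin psubset_card_mono by blast
    show thesis
    proof (rule card_Un_clique_anticlique[OF fKA KA(3,4)])
      assume "card K + card A = card (K \<union> A)"
      then show thesis using KA(5) less by linarith
    next
      fix x assume x: "x \<in> K" "x \<in> A" "card K + card A = Suc (card (K \<union> A))"
      obtain y where y: "y \<in> U" "y \<notin> K \<union> A" using psub by blast
      have "card (insert y (K \<union> A)) = card U" using y x KA(5) less fKA by simp
      then have "insert y (K \<union> A) = U" using card_subset_eq[OF fin] y sub by blast
      then show thesis using leftover[of K A y x] KA x y less by simp
    qed
  qed
qed

text \<open>
  If the neighbours of \<open>v\<close> form a clique, any one of them dominates \<open>v\<close>; otherwise \<open>A\<close> contains a vertex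
  different from the one shared with \<open>K\<close>.
\<close>

lemma ex_Suc_num_max_both_if_full_nbrs:
  assumes fin: "finite V" and v: "v \<in> V" and ne: "nbrs V E v \<noteq> {}"
    and full: "has_pair (Suc (card (nbrs V E v))) (nbrs V E v) E"
  shows "\<exists>u\<in>V. Suc (num_max_both (V - {u}) E) \<le> num_max_both V E"
proof -
  have sub: "nbrs V E v \<subseteq> V" by (auto simp: nbrs_def)
  then have "finite (nbrs V E v)" using fin finite_subset by blast
  then obtain K A x where KA: "clique K E" "clique A (- E)" "K \<union> A = nbrs V E v" "x \<in> K" "x \<in> A"
    using has_pair_full[OF _ full] by metis
  show ?thesis
  proof (cases "A \<subseteq> K")
    case True
    then have K: "nbrs V E v = K" using KA(3) by blast
    have "Suc (num_max_both (V - {x}) E) \<le> num_max_both V E"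
    proof (rule Suc_num_max_both_if_dominated[OF fin _ v])
      fix w assume "w \<in> nbrs V E v"
      then show "w = x \<or> {w, x} \<in> E" using K KA(1,4) cliqueD by metis
    qed (use K KA in blast)
    then show ?thesis using K KA(4) sub by blast
  next
    case False
    then obtain a where a: "a \<in> A" "a \<notin> K" by blast
    then have "Suc (num_max_both (V - {a}) E) \<le> num_max_both V E"
      by (intro Suc_num_max_both_if_split_nbrs[OF fin v _ KA(1,2), of x a]) (use KA in auto)
    then show ?thesis using a KA(3) sub by blast
  qed
qed

text \<open>
  Either a clique and an anticlique of the same total size cover \<open>V - {v}\<close>, or the 4-cycle is present.
  The assumption that \<open>x\<close> and \<open>y\<close> are adjacent can be achieved by complementation, which exchanges \<open>K\<close> and \<open>A\<close>.
\<close>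

lemma ex_delete_two_if_one_left_over:
  assumes fin: "finite V" and v: "v \<in> V" and U: "V - {v} = insert y (K \<union> A)" "y \<notin> K \<union> A"
    and KA: "clique K E" "clique A (- E)" and x: "x \<in> K" "x \<in> A" "{x, y} \<in> E"
    and card: "card K + card A = card (V - {v})"
    and few: "num_max_both (V - {v}) E \<le> num_max_both (V - {v} - {y}) E + 2"
    and no: "\<not> has_pair (card V) V E"
  shows "\<exists>u\<in>V. num_max_both (V - {u}) E + 2 \<le> num_max_both V E"
proof -
  have finU: "finite (V - {v})" using fin by simp
  have cV: "Suc (card K + card A) = card V" using card card_Suc_Diff1[OF fin v] by simp
  have noU: "\<not> has_pair (Suc (card K + card A)) (V - {v}) E"
    using no cV has_pair_mono[of "card V" "V - {v}" E V "card V"] by auto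
  show ?thesis
  proof (rule split_plus_vertex_structure[OF finU U KA x noU few])
    fix K' A' assume *: "clique K' E" "clique A' (- E)" "K' \<union> A' = V - {v}"
      "card K' + card A' = card K + card A"
    have "V = insert v (K' \<union> A')" "v \<notin> K' \<union> A'" using * v by auto
    from split_plus_vertex[OF fin this *(1,2)] show ?thesis using no * cV v by auto
  next
    fix k a assume *: "k \<in> K" "a \<in> A" "{k, y} \<notin> E" "a \<noteq> x"
      "\<And>b. b \<in> A \<Longrightarrow> {b, y} \<in> E \<longleftrightarrow> b = x \<or> b = a"
      "\<And>b. b \<in> A \<Longrightarrow> {b, k} \<in> E \<longleftrightarrow> b = x \<or> b = a"
    show ?thesis
      by (rule delete_two_at_four_cycle[OF fin _ _ _ U(2) KA x *, of v]) (use U v in auto)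
  qed
qed

text \<open>
  Only the third bound is wanted in the end. Its induction step uses the second one for smaller
  sets, and both of them use the first.
\<close>

theorem num_max_both_bounds:
  assumes "finite V" "V \<noteq> {}"
  shows "Suc (card V) \<le> num_max_both V E
    \<and> (num_max_both V E \<le> Suc (card V) \<longrightarrow> has_pair (Suc (card V)) V E)
    \<and> (num_max_both V E \<le> card V + 2 \<longrightarrow> has_pair (card V) V E)"
  using assms
proof (induction V rule: finite_psubset_induct)
  case (psubset V)
  let ?N = "\<lambda>U. num_max_both U E"
  note fin = psubset.hyps
  have IH: "Suc (card U) \<le> ?N U" "?N U \<le> Suc (card U) \<Longrightarrow> has_pair (Suc (card U)) U E"
    "?N U \<le> card U + 2 \<Longrightarrow> has_pair (card U) U E" if "U \<subset> V" "U \<noteq> {}" for U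
    using psubset.IH[OF that] by blast+
  show ?case
  proof (cases "\<exists>v. V = {v}")
    case True
    then obtain v where V: "V = {v}" by blast
    have "2 \<le> ?N V"
      using num_max_cliques_pos[OF fin, of E] num_max_cliques_pos[OF fin, of "- E"]
      by (simp add: num_max_both_def)
    moreover have "has_pair 2 V E"
      by (rule has_pairI[of "{v}" _ "{v}"]) (auto simp: V clique_def)
    ultimately show ?thesis using has_pair_mono[of 2 V E V "card V"] V by (simp add: numeral_2_eq_2)
  next
    case notsing: False
    have delete: "V - {u} \<subset> V" "V - {u} \<noteq> {}" "Suc (card (V - {u})) = card V" if "u \<in> V" for u
      using notsing that card_Suc_Diff1[OF fin that] by blast+
    show ?thesis
    proof (cases "\<exists>v\<in>V. nbrs V E v = {} \<or> nbrs V (- E) v = {}")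
      case True
      then obtain v F where v: "v \<in> V" "nbrs V F v = {}" and F: "F = E \<or> F = - E" by blast
      have NF: "num_max_both U F = ?N U" "has_pair m U F = has_pair m U E" for m U
        using F by auto
      have "V \<noteq> {v}" using notsing by blast
      then have gain: "Suc (?N (V - {v})) \<le> ?N V"
        using num_max_both_isolated[OF fin v(1) _ v(2)] NF by simp
      have lift: "has_pair (Suc m) V E" if "has_pair m (V - {v}) E" for m
        using has_pair_isolated[OF fin v] NF that by simp
      note IHv = IH[OF delete(1,2)[OF v(1)]] and c = delete(3)[OF v(1)]
      have "Suc (card V) \<le> ?N V" using IHv(1) gain c by linarith
      moreover have "has_pair (Suc (card V)) V E" if "?N V \<le> Suc (card V)"
      proof -
        have "?N (V - {v}) \<le> Suc (card (V - {v}))" using that gain c by linarith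
        then show ?thesis using lift[OF IHv(2)] c by simp
      qed
      moreover have "has_pair (card V) V E" if "?N V \<le> card V + 2"
      proof -
        have "?N (V - {v}) \<le> card (V - {v}) + 2" using that gain c by linarith
        then show ?thesis using lift[OF IHv(3)] c by simp
      qed
      ultimately show ?thesis by blast
    next
      case False
      then have ne: "nbrs V E v \<noteq> {}" "nbrs V (- E) v \<noteq> {}" if "v \<in> V" for v
        using that by blast+
      obtain v where v: "v \<in> V" using psubset.prems by blast
      let ?H = "nbrs V E v" and ?H' = "nbrs V (- E) v"
      have HV: "?H \<subset> V" "?H' \<subset> V" using v by (auto simp: nbrs_def)
      have "?H \<inter> ?H' = {}" "?H \<union> ?H' = V - {v}" by (auto simp: nbrs_def)
      then have "card ?H + card ?H' = card (V - {v})"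
        using card_Un_disjoint[of ?H ?H'] fin HV finite_subset[of _ V] by (metis psubset_imp_subset)
      then have cH: "Suc (card ?H + card ?H') = card V" using delete(3)[OF v] by simp
      have split: "?N ?H + ?N ?H' \<le> ?N V" by (rule num_max_both_split[OF fin v ne[OF v]])
      have H1: "Suc (card ?H) \<le> ?N ?H" "Suc (card ?H') \<le> ?N ?H'"
        using IH(1) HV ne[OF v] by blast+
      have lower: "Suc (card V) \<le> ?N V" using split H1 cH by linarith
      \<comment> \<open>\<open>H\<close> and \<open>H'\<close> cannot both exceed the lower bound (i), or \<open>N V\<close> would be at least \<open>|V| + 3\<close>.\<close>
      have gain: "\<exists>u\<in>V. Suc (?N (V - {u})) \<le> ?N V" if "?N V \<le> card V + 2"
      proof -
        have "?N ?H \<le> Suc (card ?H) \<or> ?N ?H' \<le> Suc (card ?H')"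
          using that split H1 cH by linarith
        then show ?thesis
        proof
          assume "?N ?H \<le> Suc (card ?H)"
          then have "has_pair (Suc (card ?H)) ?H E" using IH(2) HV ne[OF v] by blast
          then show ?thesis by (rule ex_Suc_num_max_both_if_full_nbrs[OF fin v ne(1)[OF v]])
        next
          assume "?N ?H' \<le> Suc (card ?H')"
          then have "has_pair (Suc (card ?H')) ?H' (- E)"
            using IH(2) HV ne[OF v] has_pair_uminus by blast
          then show ?thesis
            using ex_Suc_num_max_both_if_full_nbrs[OF fin v ne(2)[OF v]] by simp
        qed
      qed
      have tight: "has_pair (Suc (card V)) V E" if N: "?N V \<le> Suc (card V)"
      proof -
        obtain u where u: "u \<in> V" "Suc (?N (V - {u})) \<le> ?N V" using gain N by auto
        have "?N (V - {u}) \<le> Suc (card (V - {u}))" using u(2) N delete(3)[OF u(1)] by linarith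
        then have "has_pair (Suc (card (V - {u}))) (V - {u}) E"
          using IH(2) delete(1,2)[OF u(1)] by blast
        then obtain K A x where KA: "clique K E" "clique A (- E)" "K \<union> A = V - {u}"
          "card K + card A = Suc (card (V - {u}))"
          using has_pair_full[of "V - {u}" E] fin by (metis finite_Diff)
        have "V = insert u (K \<union> A)" "u \<notin> K \<union> A" using KA(3) u by auto
        from split_plus_vertex[OF fin this KA(1,2)]
        have "?N (V - {u}) + 2 \<le> ?N V \<or> has_pair (Suc (card V)) V E"
          using KA(4) delete(3)[OF u(1)] by simp
        moreover have "card V \<le> ?N (V - {u})"
          using IH(1)[OF delete(1,2)[OF u(1)]] delete(3)[OF u(1)] by simp
        ultimately show ?thesis using N by linarith
      qed
      have "has_pair (card V) V E" if N: "?N V \<le> card V + 2"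
      proof (rule ccontr)
        assume no: "\<not> has_pair (card V) V E"
        have no2: "\<not> ?N (V - {u}) + 2 \<le> ?N V" if u: "u \<in> V" for u
        proof
          assume "?N (V - {u}) + 2 \<le> ?N V"
          then have "?N (V - {u}) \<le> Suc (card (V - {u}))" using N delete(3)[OF u] by linarith
          then have "has_pair (Suc (card (V - {u}))) (V - {u}) E"
            using IH(2) delete(1,2)[OF u] by blast
          then show False using no delete(3)[OF u] has_pair_mono[of "card V" "V - {u}" E V] by auto
        qed
        obtain u where u: "u \<in> V" "Suc (?N (V - {u})) \<le> ?N V" using gain N by blast
        have N': "?N (V - {u}) \<le> card (V - {u}) + 2" using u(2) N delete(3)[OF u(1)] by linarith
        then have pair: "has_pair (card (V - {u})) (V - {u}) E"
          using IH(3) delete(1,2)[OF u(1)] by blast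
        have finU: "finite (V - {u})" using fin by simp
        show False
        proof (rule has_pair_all_but_one[OF finU pair])
          fix K A assume KA: "clique K E" "clique A (- E)" "K \<union> A = V - {u}"
            "card (V - {u}) \<le> card K + card A"
          have "V = insert u (K \<union> A)" "u \<notin> K \<union> A" using KA(3) u by auto
          from split_plus_vertex[OF fin this KA(1,2)] no2[OF u(1)]
          have "has_pair (Suc (card K + card A)) V E" by blast
          moreover have "card V \<le> Suc (card K + card A)" using KA(4) delete(3)[OF u(1)] by simp
          ultimately show False using no has_pair_mono by blast
        next
          fix K A x y assume KA: "clique K E" "clique A (- E)" "V - {u} = insert y (K \<union> A)"
            "y \<notin> K \<union> A" "x \<in> K" "x \<in> A" "card K + card A = card (V - {u})"
          have yU: "y \<in> V - {u}" "V - {u} - {y} = K \<union> A" using KA by auto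
          have "V - {u} - {y} \<subset> V" "V - {u} - {y} \<noteq> {}" using yU KA(5) by blast+
          then have "Suc (card (V - {u} - {y})) \<le> ?N (V - {u} - {y})" by (rule IH(1))
          then have few: "?N (V - {u}) \<le> ?N (V - {u} - {y}) + 2"
            using N' card_Suc_Diff1[OF finU yU(1)] by linarith
          show False
          proof (cases "{x, y} \<in> E")
            case True
            then show False
              using ex_delete_two_if_one_left_over[OF fin u(1) KA(3,4,1,2,5,6) _ KA(7) few no] no2 by blast
          next
            case False
            have "\<exists>w\<in>V. num_max_both (V - {w}) (- E) + 2 \<le> num_max_both V (- E)"
              by (rule ex_delete_two_if_one_left_over[OF fin u(1), of y A K _ x])
                (use False KA few no in \<open>auto simp: Un_commute add.commute\<close>)
            then show False using no2 by simp
          qed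
        qed
      qed
      then show ?thesis using lower tight by blast
    qed
  qed
qed

lemma indep_eq_clique: "indep A E \<longleftrightarrow> clique A (- E)"
  by (simp add: indep_def clique_def)

lemma anticliques_eq_cliques: "anticliques V E = cliques V (- E)"
  by (simp add: anticliques_def cliques_def indep_eq_clique)

theorem lemma33:
  fixes V :: "'a set" and E :: "'a set set"
  assumes "simple_graph V E"
    and "tau V E \<le> 2"
  shows "clique_number V E + anticlique_number V E \<ge> card V"
proof -
  have V: "finite V" "V \<noteq> {}" using assms(1) by (auto simp: simple_graph_def)
  have "num_max_both V E \<le> card V + 2"
    using assms(2)
    by (simp add: tau_def num_max_both_def num_max_cliques_def num_max_anticliques_def
        anticliques_eq_cliques)
  then obtain K A where KA: "K \<in> cliques V E" "A \<in> anticliques V E" "card V \<le> card K + card A"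
    using num_max_both_bounds[OF V, of E]
    by (auto simp: has_pair_def cliques_def anticliques_eq_cliques)
  have "card K \<le> clique_number V E" "card A \<le> anticlique_number V E"
    unfolding clique_number_def anticlique_number_def
    using KA V(1) by (auto intro!: Max_ge simp: finite_cliques finite_anticliques)
  then show ?thesis using KA(3) by linarith
qed

end
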